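(* Let $m>3$, let $\lambda$ be a nontrivial coloring on $\mathrm{P}^3(m)$, and let $\{e_1,e_2,e_3\}$ be a basis of $(\mathbb{Z}_2)^3$ with $\lambda(c)=e_1$ and $\lambda(f)=e_1+e_2$. Then $\lambda$ is sector-equivalent to the canonical form $\lambda_{C_*}$, the coloring with $\lambda_{C_*}(c)=e_1$, $\lambda_{C_*}(f)=e_1+e_2$ and coloring sequence $$\mathcal{C}_*=(e_2,x_1,e_2,\dots,e_2,x_{m_\lambda},e_2,y_1,\dots,e_2,y_{n_\lambda-m_\lambda},z_1,\dots,z_{m-2n_\lambda}),$$ where $x_i=e_1+e_3$ if $i$ is odd and $x_i=e_3$ if $i$ is even; $y_i=e_3$ for all $1\le i\le n_\lambda-m_\lambda$; and $z_i=e_2+e_3$ if $i$ is odd and $z_i=e_3$ if $i$ is even.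
   Context: $\mathrm{P}^3(m)=[0,1]\times(m\text{-gon})$, with ceiling $c$ and floor $f$ (the two $m$-gon faces; for $m=4$ a fixed pair of opposite faces) and side faces $s_1,\dots,s_m$ in cyclic order (indices mod $m$). A coloring $\lambda$ assigns to each facet a vector of $(\mathbb{Z}_2)^3$ such that facets with nonempty common intersection get linearly independent vectors. $\lambda$ is nontrivial if $\lambda(c)\ne\lambda(f)$. With the colors of $c,f$ given, a coloring is described by its coloring sequence $(\lambda(s_1),\dots,\lambda(s_m))$, viewed cyclically. For nontrivial $\lambda$ put $\lambda_0=\lambda(c)-\lambda(f)$; $n_\lambda$ is the number of $i$ with $\lambda(s_i)=\lambda_0$, and $m_\lambda$ is the number of $i$ with $\mathrm{Span}\{\lambda(s_{i-1}),\lambda(s_i),\lambda(s_{i+1})\}=(\mathbb{Z}_2)^3$. Sector-equivalence of nontrivial colorings is the equivalence relation generated by: (i) $\lambda\mapsto\sigma\circ\lambda$ with $\sigma\in\mathrm{GL}(3,\mathbb{Z}_2)$ (Davis–Januszkiewicz equivalence); (ii) cyclic rotation or reversal of the order of the side faces; (iii) the following operations for $k<l$, which change only the colors of the block $s_k,s_{k+1},\dots,s_l$: $\bar{\mathrm{O}}_{21}$: if $\lambda(s_k)=\lambda(s_l)=\lambda_0$, apply to each entry of the block the linear map that is the identity on $\mathrm{Span}\{\lambda(c),\lambda_0\}$ and sends each $v$ outside it to $v+\lambda_0$. $\mathrm{O}_{31}$: if $\lambda(s_k)=\lambda(s_l)\neq\lambda_0$, reverse the block. $\mathrm{O}_4$: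 if $\lambda(s_k)-\lambda(s_l)\in\{\lambda(c),\lambda(f)\}$, reverse the block and apply to each entry the linear map fixing $\lambda_0$ and interchanging $\lambda(s_k)$ and $\lambda(s_l)$. $\mathrm{O}_5$: if $\lambda(s_k)-\lambda(s_l)=\lambda_0$, reverse the block and apply to each entry the linear map fixing $\lambda(c)$ and interchanging $\lambda(s_k)$ and $\lambda(s_l)$. *)

theory Defs
  imports "HOL-Analysis.Analysis" "HOL-Library.Z2"
begin

type_synonym z2_cube = "bit ^ 3"

section \<open>The prism over an m-gon\<close>

text \<open>
  The side facet \<open>s\<^sub>i\<close> with \<open>1 \<le> i \<le> m\<close> is \<open>Side (i - 1)\<close>; indices are counted from \<open>0\<close> throughout.
\<close>

datatype facet = Ceiling | Floor | Side nat

definition facets :: "nat \<Rightarrow> facet set" where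
  "facets m = {Ceiling, Floor} \<union> Side ` {..<m}"

text \<open>
  The vertices of the prism are the pairs \<open>(b, i)\<close>, where \<open>i < m\<close> is a vertex of the m-gon and \<open>b\<close>
  tells whether it is taken in the ceiling or in the floor. The side \<open>i\<close> of the m-gon joins its
  vertices \<open>i\<close> and \<open>i + 1\<close> (cyclically). A nonempty intersection of facets of a polytope is a face
  and hence contains a vertex, so facets intersect iff their vertex sets do.
\<close>

fun facet_vertices :: "nat \<Rightarrow> facet \<Rightarrow> (bool \<times> nat) set" where
  "facet_vertices m Ceiling = {True} \<times> {..<m}"
| "facet_vertices m Floor = {False} \<times> {..<m}"
| "facet_vertices m (Side i) = UNIV \<times> {i, Suc i mod m}"

section \<open>Colorings\<close>

datatype coloring =
  Coloring (ceiling_color: z2_cube) (floor_color: z2_cube) (side_colors: "z2_cube list")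

fun color :: "coloring \<Rightarrow> facet \<Rightarrow> z2_cube" where
  "color L Ceiling = ceiling_color L"
| "color L Floor = floor_color L"
| "color L (Side i) = side_colors L ! i"

text \<open>
  Injectivity on \<open>F\<close> is needed because linear independence is meant for the family of colors, whereas
  \<open>vec.independent\<close> speaks about the set of colors.
\<close>

definition is_coloring :: "nat \<Rightarrow> coloring \<Rightarrow> bool" where
  "is_coloring m L \<longleftrightarrow>
     length (side_colors L) = m \<and>
     (\<forall>F \<subseteq> facets m. (\<Inter>x\<in>F. facet_vertices m x) \<noteq> {} \<longrightarrow>
        inj_on (color L) F \<and> vec.independent (color L ` F))"

definition nontrivial_coloring :: "nat \<Rightarrow> coloring \<Rightarrow> bool" where
  "nontrivial_coloring m L \<longleftrightarrow> is_coloring m L \<and> color L Ceiling \<noteq> color L Floor"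

definition lambda0 :: "coloring \<Rightarrow> z2_cube" where
  "lambda0 L = color L Ceiling - color L Floor"

definition n_num :: "nat \<Rightarrow> coloring \<Rightarrow> nat" where
  "n_num m L = card {i. i < m \<and> color L (Side i) = lambda0 L}"

definition m_num :: "nat \<Rightarrow> coloring \<Rightarrow> nat" where
  "m_num m L = card {i. i < m \<and>
     vec.span {color L (Side ((i + m - 1) mod m)), color L (Side i), color L (Side (Suc i mod m))}
       = UNIV}"

section \<open>Sector-equivalence\<close>

definition on_block :: "nat \<Rightarrow> nat \<Rightarrow> ('a list \<Rightarrow> 'a list) \<Rightarrow> 'a list \<Rightarrow> 'a list" where
  "on_block k l g s = take k s @ g (take (Suc l - k) (drop k s)) @ drop (Suc l) s"

abbreviation z2_linear :: "(z2_cube \<Rightarrow> z2_cube) \<Rightarrow> bool" where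
  "z2_linear \<equiv> Vector_Spaces.linear (*s) (*s)"

text \<open>
  In \<open>O4\<close> and \<open>O5\<close> the linear map \<open>T\<close> is unique if the source is a coloring, since \<open>T\<close> is then
  prescribed on a basis.
\<close>

inductive sector_move :: "coloring \<Rightarrow> coloring \<Rightarrow> bool" where
  DJ: "z2_linear T \<Longrightarrow> bij T \<Longrightarrow>
    sector_move (Coloring c f s) (Coloring (T c) (T f) (map T s))"
| rotation: "sector_move (Coloring c f s) (Coloring c f (rotate j s))"
| reversal: "sector_move (Coloring c f s) (Coloring c f (rev s))"
| O21: "k < l \<Longrightarrow> l < length s \<Longrightarrow> s ! k = c - f \<Longrightarrow> s ! l = c - f \<Longrightarrow>
    sector_move (Coloring c f s)
      (Coloring c f (on_block k l
        (map (\<lambda>v. if v \<in> vec.span {c, c - f} then v else v + (c - f))) s))"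
| O31: "k < l \<Longrightarrow> l < length s \<Longrightarrow> s ! k = s ! l \<Longrightarrow> s ! k \<noteq> c - f \<Longrightarrow>
    sector_move (Coloring c f s) (Coloring c f (on_block k l rev s))"
| O4: "k < l \<Longrightarrow> l < length s \<Longrightarrow> s ! k - s ! l \<in> {c, f} \<Longrightarrow>
    z2_linear T \<Longrightarrow> T (c - f) = c - f \<Longrightarrow> T (s ! k) = s ! l \<Longrightarrow> T (s ! l) = s ! k \<Longrightarrow>
    sector_move (Coloring c f s) (Coloring c f (on_block k l (\<lambda>b. map T (rev b)) s))"
| O5: "k < l \<Longrightarrow> l < length s \<Longrightarrow> s ! k - s ! l = c - f \<Longrightarrow>
    z2_linear T \<Longrightarrow> T c = c \<Longrightarrow> T (s ! k) = s ! l \<Longrightarrow> T (s ! l) = s ! k \<Longrightarrow>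
    sector_move (Coloring c f s) (Coloring c f (on_block k l (\<lambda>b. map T (rev b)) s))"

definition sector_equivalent :: "nat \<Rightarrow> coloring \<Rightarrow> coloring \<Rightarrow> bool" where
  "sector_equivalent m =
     equivclp (\<lambda>L L'. nontrivial_coloring m L \<and> nontrivial_coloring m L' \<and> sector_move L L')"

section \<open>The canonical form\<close>

text \<open>
  Here \<open>p\<close> and \<open>n\<close> stand for \<open>m\<^sub>\<lambda>\<close> and \<open>n\<^sub>\<lambda>\<close>. The list has length \<open>m\<close> iff \<open>p \<le> n\<close> and \<open>2 * n \<le> m\<close>, so for
  a coloring of the prism with this sequence of side colors no subtraction below is truncated.
\<close>

definition canonical_sequence ::
  "z2_cube \<Rightarrow> z2_cube \<Rightarrow> z2_cube \<Rightarrow> nat \<Rightarrow> nat \<Rightarrow> nat \<Rightarrow> z2_cube list" where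
  "canonical_sequence e1 e2 e3 m p n =
     concat (map (\<lambda>i. [e2, if odd i then e1 + e3 else e3]) [1..<Suc p]) @
     concat (map (\<lambda>i. [e2, e3]) [1..<Suc (n - p)]) @
     map (\<lambda>i. if odd i then e2 + e3 else e3) [1..<Suc (m - 2 * n)]"

definition canonical_coloring ::
  "z2_cube \<Rightarrow> z2_cube \<Rightarrow> z2_cube \<Rightarrow> nat \<Rightarrow> nat \<Rightarrow> nat \<Rightarrow> coloring" where
  "canonical_coloring e1 e2 e3 m p n =
     Coloring e1 (e1 + e2) (canonical_sequence e1 e2 e3 m p n)"

end

theory Submission
  imports Defs
begin

text \<open>
  With \<open>\<lambda>(c) = e1\<close> and \<open>\<lambda>(f) = e1 + e2\<close>, a side is colored \<open>\<lambda>\<^sub>0 = e2\<close> or \<open>e3 + a e1 + b e2\<close>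
  for two bits \<open>a\<close> (the mark) and \<open>b\<close> (the phase). Two neighbouring sides are never both colored
  \<open>\<lambda>\<^sub>0\<close>, and if neither is, they have the same mark and opposite phases. So for \<open>n\<^sub>\<lambda> > 0\<close> the
  \<open>\<lambda>\<^sub>0\<close>-sides cut the cycle into \<open>n\<^sub>\<lambda>\<close> nonempty segments, each given by its mark, its initial phase
  and its length, and \<open>m\<^sub>\<lambda>\<close> counts the \<open>\<lambda>\<^sub>0\<close>-sides at which the mark changes.

  The phase of a single segment can be switched by \<open>O21\<close>. Reversing, by \<open>O31\<close> or \<open>O4\<close>, a block
  between two sides of equal phase, neither colored \<open>\<lambda>\<^sub>0\<close>, reverses the order of the
  \<open>\<lambda>\<^sub>0\<close>-sides inside it, each of which keeps its property of changing or preserving the mark.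
  Applied to a block with one \<open>\<lambda>\<^sub>0\<close>-side this moves length from one segment to the next; applied to a block with two, it swaps adjacent
  entries in the sequence of mark changes. Hence this sequence can be sorted and all excess length
  collected in the last segment, which gives the canonical form. Since the number of mark
  changes around a cycle is even, the last segment then has mark \<open>0\<close>. If \<open>n\<^sub>\<lambda> = 0\<close>, the coloring is
  one alternating cycle, and a linear change of colors suffices.
\<close>

section \<open>Linear algebra over two elements\<close>

lemma z2_add_self [simp]: "x + x = (0 :: z2_cube)"
  by (simp add: vec_eq_iff)

lemma z2_add_self_left [simp]: "x + (x + y) = (y :: z2_cube)"
  by (simp flip: add.assoc)

lemma z2_minus [simp]: "x - y = x + (y :: z2_cube)"
  by (simp add: vec_eq_iff)

lemma z2_add_eq_0_iff: "x + y = 0 \<longleftrightarrow> x = (y :: z2_cube)"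
  by (metis z2_add_self_left add.right_neutral)

lemma ex_bit_iff: "(\<exists>k::bit. P k) \<longleftrightarrow> P 0 \<or> P 1"
  by (metis bit.exhaust)

text \<open>Over two elements a coefficient is \<open>0\<close> or \<open>1\<close>, so membership
  in a span unfolds into finitely many equations.\<close>

lemma z2_span_insert: "x \<in> vec.span (insert a S) \<longleftrightarrow> x \<in> vec.span S \<or> x + a \<in> vec.span (S :: z2_cube set)"
  by (simp add: vec.span_breakdown_eq ex_bit_iff)

lemma z2_independent_insert:
  "x \<notin> S \<and> vec.independent (insert x S) \<longleftrightarrow> vec.independent (S :: z2_cube set) \<and> x \<notin> vec.span S"
  by (auto simp: vec.independent_insert vec.span_base)

text \<open>A nontrivial relation over two elements is a vanishing sum of a nonempty subfamily; the
  seven conditions exclude these sums one by one.\<close>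

lemma z2_independent3_iff:
  fixes x y z :: z2_cube
  shows "(x \<noteq> y \<and> x \<noteq> z \<and> y \<noteq> z \<and> vec.independent {x, y, z}) \<longleftrightarrow>
    x \<noteq> 0 \<and> y \<noteq> 0 \<and> z \<noteq> 0 \<and> x \<noteq> y \<and> x \<noteq> z \<and> y \<noteq> z \<and> x + y + z \<noteq> 0"
  using z2_independent_insert[of x "{y, z}"] z2_independent_insert[of y "{z}"] z2_independent_insert[of z "{}"]
  by (auto simp: z2_span_insert z2_add_eq_0_iff add.assoc)

locale z2_basis =
  fixes e1 e2 e3 :: z2_cube
  assumes indep: "vec.independent {e1, e2, e3}"
    and span: "vec.span {e1, e2, e3} = UNIV"
begin

text \<open>Boolean coordinates turn addition into \<open>\<noteq>\<close>, so that identities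
  between vectors reduce to case splits.\<close>

definition comb :: "bool \<Rightarrow> bool \<Rightarrow> bool \<Rightarrow> z2_cube" where
  "comb a b c = (if a then e1 else 0) + (if b then e2 else 0) + (if c then e3 else 0)"

lemma comb_add: "comb a b c + comb a' b' c' = comb (a \<noteq> a') (b \<noteq> b') (c \<noteq> c')"
  by (cases a; cases b; cases c; cases a'; cases b'; cases c') (simp_all add: comb_def add_ac)

lemma comb_surj: "\<exists>a b c. v = comb a b c"
proof -
  have "v \<in> vec.span {e1, e2, e3}"
    by (simp add: span)
  then have "v = 0 \<or> v = e3 \<or> v = e2 \<or> v = e2 + e3 \<or> v = e1 \<or> v = e1 + e3 \<or> v = e1 + e2 \<or> v = e1 + (e2 + e3)"
    by (simp only: z2_span_insert vec.span_empty singleton_iff add.assoc z2_add_eq_0_iff) blast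
  moreover have "comb False False False = 0" "comb False False True = e3" "comb False True False = e2"
    "comb False True True = e2 + e3" "comb True False False = e1" "comb True False True = e1 + e3"
    "comb True True False = e1 + e2" "comb True True True = e1 + (e2 + e3)"
    by (simp_all add: comb_def add.assoc)
  ultimately show ?thesis
    by metis
qed

text \<open>Independence is assumed of a set, which might have collapsed; spanning a space of
  dimension \<open>3\<close> forces three distinct elements.\<close>

lemma distinct_basis: "e1 \<noteq> e2" "e1 \<noteq> e3" "e2 \<noteq> e3"
proof -
  have "vec.dim (UNIV :: z2_cube set) \<le> card {e1, e2, e3}"
    by (rule vec.dim_le_card) (auto simp: span)
  then have "3 \<le> card {e1, e2, e3}"
    by (simp add: card_cart_basis)
  moreover have "card {x, y} \<le> 2" for x y :: z2_cube
    by (simp add: card_insert_if)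
  ultimately have "{e1, e2, e3} \<noteq> {x, y}" for x y
    by (metis Suc_n_not_le_n eval_nat_numeral(3) order_trans)
  then show "e1 \<noteq> e2" "e1 \<noteq> e3" "e2 \<noteq> e3"
    by blast+
qed

lemma comb_eq_0_iff: "comb a b c = 0 \<longleftrightarrow> \<not> a \<and> \<not> b \<and> \<not> c"
proof -
  have "e1 \<noteq> 0 \<and> e2 \<noteq> 0 \<and> e3 \<noteq> 0 \<and> e1 + e2 + e3 \<noteq> 0"
    using z2_independent3_iff[of e1 e2 e3] distinct_basis indep by blast
  then show ?thesis
    using distinct_basis by (cases a; cases b; cases c) (simp_all add: comb_def z2_add_eq_0_iff)
qed

lemma comb_inj: "comb a b c = comb a' b' c' \<longleftrightarrow> a = a' \<and> b = b' \<and> c = c'"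
proof -
  have "comb a b c = comb a' b' c' \<longleftrightarrow> comb a b c + comb a' b' c' = 0"
    by (simp add: z2_add_eq_0_iff)
  then show ?thesis
    by (auto simp: comb_add comb_eq_0_iff)
qed

text \<open>The map fixes \<open>e1\<close> and \<open>e2\<close> and adds
  \<open>comb p q False\<close> to \<open>e3\<close>. It is an involution, hence bijective.\<close>

lemma shear_exists:
  "\<exists>T. z2_linear T \<and> bij T \<and> (\<forall>a b c. T (comb a b c) = comb (a \<noteq> (c \<and> p)) (b \<noteq> (c \<and> q)) c)"
proof -
  obtain T where lin: "z2_linear T"
    and T: "\<forall>x\<in>{e1, e2, e3}. T x = (if x = e3 then comb p q True else x)"
    using vec.linear_independent_extend[OF indep, of "\<lambda>x. if x = e3 then comb p q True else x"] by blast
  interpret T: Vector_Spaces.linear "(*s)" "(*s)" T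
    by (fact lin)
  have *: "T (comb a b c) = comb (a \<noteq> (c \<and> p)) (b \<noteq> (c \<and> q)) c" for a b c
  proof -
    have "T e1 = e1" "T e2 = e2" "T e3 = comb p q True"
      using T distinct_basis by simp_all
    then have "T (comb a b c) = comb a b False + (if c then comb p q True else 0)"
      by (cases a; cases b; cases c) (simp_all add: comb_def T.add T.zero)
    then show ?thesis
      by (cases c) (simp_all add: comb_add)
  qed
  have "T (T v) = v" for v
  proof -
    obtain a b c where v: "v = comb a b c"
      using comb_surj by blast
    show ?thesis
      unfolding v * comb_inj by blast
  qed
  then have "bij T"
    by (simp add: involuntory_imp_bij)
  with lin * show ?thesis
    by blast
qed

lemma span3_eq_UNIV_iff:
  "vec.span {x, y, z} = UNIV \<longleftrightarrow> {e1, e2, e3} \<subseteq> vec.span {x, y, z}"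
  using vec.span_minimal[of "{e1, e2, e3}" "vec.span {x, y, z}"] by (auto simp: span)

end

section \<open>Colorings as cyclic words\<close>

text \<open>\<open>Z\<close> stands for the color \<open>\<lambda>\<^sub>0\<close> and \<open>V a b\<close> for \<open>e3 + a e1 + b e2\<close>.\<close>

datatype letter = Z | V (mark: bool) bool

fun adj :: "letter \<Rightarrow> letter \<Rightarrow> bool" where
  "adj Z Z \<longleftrightarrow> False"
| "adj Z (V a b) \<longleftrightarrow> True"
| "adj (V a b) Z \<longleftrightarrow> True"
| "adj (V a b) (V a' b') \<longleftrightarrow> a = a' \<and> b \<noteq> b'"

definition cyc_adj :: "letter list \<Rightarrow> bool" where
  "cyc_adj w \<longleftrightarrow> successively adj w \<and> (w \<noteq> [] \<longrightarrow> adj (last w) (hd w))"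

lemma adj_commute: "adj x y \<longleftrightarrow> adj y x"
  by (cases x; cases y) auto

text \<open>The definition suits cutting and gluing of words; the indexed form matches the
  neighbouring facets \<open>Side i\<close> and \<open>Side (Suc i mod m)\<close>.\<close>

lemma cyc_adj_nth:
  "cyc_adj w \<longleftrightarrow> (\<forall>i<length w. adj (w ! i) (w ! (Suc i mod length w)))"
proof (cases "w = []")
  case False
  then obtain n where n: "length w = Suc n"
    by (cases w) auto
  have "cyc_adj w \<longleftrightarrow> (\<forall>i<n. adj (w ! i) (w ! Suc i)) \<and> adj (w ! n) (w ! 0)"
    using False n by (simp add: cyc_adj_def successively_conv_nth last_conv_nth hd_conv_nth)
  also have "\<dots> \<longleftrightarrow> (\<forall>i<Suc n. adj (w ! i) (w ! (Suc i mod Suc n)))"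
    by (auto simp: less_Suc_eq mod_Suc)
  finally show ?thesis
    by (simp add: n)
qed (simp add: cyc_adj_def)

context z2_basis
begin

fun val :: "letter \<Rightarrow> z2_cube" where
  "val Z = comb False True False"
| "val (V a b) = comb a b True"

abbreviation prism_coloring :: "letter list \<Rightarrow> coloring" where
  "prism_coloring w \<equiv> Coloring e1 (e1 + e2) (map val w)"

lemma inj_val: "inj val"
  by (rule injI, rename_tac x y, case_tac x; case_tac y; simp add: comb_inj)

lemma ceiling_floor_comb:
  "c = e1 \<or> c = e1 + e2 \<longleftrightarrow> (\<exists>q. c = comb True q False)"
  by (auto simp: ex_bool_eq comb_def)

text \<open>Both values of \<open>c\<close> are needed: either one alone still allows the other one as \<open>val x + val y\<close>.\<close>

lemma independent_val_iff:
  "(\<forall>c. c = e1 \<or> c = e1 + e2 \<longrightarrow>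
      c \<noteq> val x \<and> c \<noteq> val y \<and> val x \<noteq> val y \<and> vec.independent {c, val x, val y}) \<longleftrightarrow> adj x y"
proof -
  have "(\<forall>q. comb True q False \<noteq> 0 \<and> val x \<noteq> 0 \<and> val y \<noteq> 0 \<and> comb True q False \<noteq> val x \<and>
      comb True q False \<noteq> val y \<and> val x \<noteq> val y \<and> comb True q False + val x + val y \<noteq> 0) \<longleftrightarrow> adj x y"
  proof (cases x)
    case x: (V a b)
    show ?thesis
    proof (cases y)
      case y: (V a' b')
      show ?thesis
        unfolding x y by (cases a; cases b; cases a'; cases b') (simp_all add: comb_add comb_inj all_bool_eq comb_eq_0_iff)
    qed (simp add: x comb_add comb_inj comb_eq_0_iff)
  qed (cases y, simp_all add: comb_add comb_inj comb_eq_0_iff)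
  moreover have "(\<forall>c. (\<exists>q. c = comb True q False) \<longrightarrow> P c) \<longleftrightarrow> (\<forall>q. P (comb True q False))" for P
    by blast
  ultimately show ?thesis
    unfolding ceiling_floor_comb z2_independent3_iff by simp
qed

text \<open>Of the eight vectors, five remain: \<open>e2\<close> and the four with
  \<open>e3\<close>-coordinate \<open>1\<close>.\<close>

lemma in_range_val:
  assumes "x \<noteq> 0" "x \<noteq> e1" "x \<noteq> e1 + e2"
  shows "x \<in> range val"
proof -
  have "x \<noteq> comb False False False" "x \<noteq> comb True False False" "x \<noteq> comb True True False"
    using assms by (simp_all add: comb_def)
  moreover obtain a b c where x: "x = comb a b c"
    using comb_surj by blast
  ultimately have "x = val (if c then V a b else Z)"
    by (cases a; cases b; cases c) simp_all
  then show ?thesis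
    by blast
qed

text \<open>If \<open>y\<close> is not \<open>Z\<close>, its neighbours are \<open>Z\<close> or
  share its mark, and all three colors lie in the plane spanned by \<open>e2\<close> and
  \<open>val y\<close>. If \<open>y = Z\<close>, the colors leave the plane of \<open>e2\<close> and
  \<open>val x\<close> exactly when the marks differ.\<close>

lemma span_val_eq_UNIV_iff:
  assumes "adj x y" "adj y z"
  shows "vec.span {val x, val y, val z} = UNIV \<longleftrightarrow> y = Z \<and> mark x \<noteq> mark z"
proof -
  have "v \<in> vec.span {val x, val y, val z} \<longleftrightarrow>
    v \<in> {0, val x, val y, val z, val x + val y, val x + val z, val y + val z, val x + val y + val z}" for v
    unfolding z2_span_insert vec.span_empty singleton_iff add.assoc z2_add_eq_0_iff insert_iff empty_iff
    by blast
  then have "vec.span {val x, val y, val z} = UNIV \<longleftrightarrow> {comb True False False, comb False True False, comb False False True} \<subseteq>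
    {comb False False False, val x, val y, val z, val x + val y, val x + val z, val y + val z, val x + val y + val z}"
    unfolding span3_eq_UNIV_iff by (simp add: comb_def)
  also have "\<dots> \<longleftrightarrow> y = Z \<and> mark x \<noteq> mark z"
    using assms by (cases x; cases y; cases z) (auto simp: comb_add comb_inj comb_eq_0_iff)
  finally show ?thesis .
qed

text \<open>Facets with a common vertex are among the three facets at that vertex, and independence
  passes to subfamilies.\<close>

lemma nontrivial_prism_coloring:
  assumes "cyc_adj w" "length w = m" "m > 1"
  shows "nontrivial_coloring m (prism_coloring w)"
proof -
  let ?L = "prism_coloring w"
  have "inj_on (color ?L) F \<and> vec.independent (color ?L ` F)"
    if F: "F \<subseteq> facets m" "(\<Inter>x\<in>F. facet_vertices m x) \<noteq> {}" for F
  proof (cases "F = {}")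
    case False
    obtain p where "p \<in> (\<Inter>x\<in>F. facet_vertices m x)"
      using F(2) by blast
    then obtain \<beta> v where v: "\<And>x. x \<in> F \<Longrightarrow> (\<beta>, v) \<in> facet_vertices m x"
      by (cases p) blast
    obtain x where "x \<in> F"
      using False by blast
    then have "v < m"
      using v[of x] F(1) \<open>m > 1\<close> by (cases x) (auto simp: facets_def)
    \<comment> \<open>The sides that meet over the polygon vertex \<open>v\<close> are side
      \<open>v\<close> and its cyclic predecessor \<open>i\<close>.\<close>
    define i where "i = (if v = 0 then m - 1 else v - 1)"
    define C where "C = (if \<beta> then Ceiling else Floor)"
    have i: "i < m" "Suc i mod m = v"
      using \<open>v < m\<close> by (simp_all add: i_def less_imp_diff_less)
    have Suc_inj: "j = i" if "j < m" "v = Suc j mod m" for j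
      using that Suc_lessI[OF \<open>j < m\<close>] by (cases "Suc j = m") (simp_all add: i_def)
    have "x \<in> {C, Side i, Side (Suc i mod m)}" if x: "x \<in> F" for x
    proof (cases x)
      case (Side j)
      then have "Side j \<in> facets m" "(\<beta>, v) \<in> facet_vertices m (Side j)"
        using F(1) v[OF x] x by auto
      then have "j < m" "v = j \<or> v = Suc j mod m"
        by (auto simp: facets_def)
      then show ?thesis
        using Suc_inj[of j] i(2) Side by blast
    qed (use v[OF x] in \<open>simp_all add: C_def\<close>)
    then have sub: "F \<subseteq> {C, Side i, Side (Suc i mod m)}"
      by blast
    have "adj (w ! i) (w ! v)"
      using assms i by (auto simp: cyc_adj_nth)
    moreover define c where "c = color ?L C"
    then have "c = e1 \<or> c = e1 + e2"
      by (simp add: C_def)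
    ultimately have indep: "c \<noteq> val (w ! i) \<and> c \<noteq> val (w ! v) \<and> val (w ! i) \<noteq> val (w ! v)
        \<and> vec.independent {c, val (w ! i), val (w ! v)}"
      using independent_val_iff[of "w ! i" "w ! v"] by blast
    have "color ?L (Side i) = val (w ! i)" "color ?L (Side v) = val (w ! v)"
      using assms i(1) \<open>v < m\<close> by simp_all
    then have "inj_on (color ?L) {C, Side i, Side (Suc i mod m)}
      \<and> vec.independent (color ?L ` {C, Side i, Side (Suc i mod m)})"
      using indep by (simp add: i(2) inj_on_def flip: c_def) metis
    then show ?thesis
      using sub by (meson image_mono inj_on_subset vec.independent_mono)
  qed (simp add: vec.independent_empty)
  moreover have "e1 \<noteq> e1 + e2"
    using comb_eq_0_iff[of False True False] by (simp add: comb_def)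
  ultimately show ?thesis
    using assms(2) unfolding nontrivial_coloring_def is_coloring_def by simp
qed

text \<open>Independence at the vertices excludes \<open>0\<close>, \<open>e1\<close> and
  \<open>e1 + e2\<close> as side colors and makes neighbouring letters satisfy
  \<open>adj\<close>.\<close>

lemma nontrivial_coloring_cases:
  assumes L: "nontrivial_coloring m L" and "color L Ceiling = e1" "color L Floor = e1 + e2" and "m > 1"
  obtains w where "L = prism_coloring w" "cyc_adj w" "length w = m"
proof -
  obtain s where s: "L = Coloring e1 (e1 + e2) s"
    using assms by (cases L) auto
  then have len: "length s = m"
    using L by (simp add: nontrivial_coloring_def is_coloring_def)
  have indep: "c \<noteq> s ! i \<and> c \<noteq> s ! (Suc i mod m) \<and> s ! i \<noteq> s ! (Suc i mod m)
      \<and> vec.independent {c, s ! i, s ! (Suc i mod m)}"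
    if i: "i < m" and c: "c = e1 \<or> c = e1 + e2" for i c
  proof -
    define C where "C = (if c = e1 then Ceiling else Floor)"
    have C: "color L C = c"
      using c s by (auto simp: C_def)
    have [simp]: "Suc i mod m \<noteq> i"
      using i \<open>m > 1\<close> by (auto simp: mod_Suc)
    let ?F = "{C, Side i, Side (Suc i mod m)}"
    \<comment> \<open>Sides \<open>i\<close> and \<open>Suc i mod m\<close> meet over the polygon
      vertex \<open>Suc i mod m\<close>; the truth value \<open>c = e1\<close> selects ceiling or
      floor.\<close>
    have "(c = e1, Suc i mod m) \<in> facet_vertices m x" if "x \<in> ?F" for x
      using i that by (auto simp: C_def)
    then have "(\<Inter>x\<in>?F. facet_vertices m x) \<noteq> {}"
      by blast
    moreover have "?F \<subseteq> facets m"
      using i by (auto simp: facets_def C_def)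
    ultimately have "inj_on (color L) ?F \<and> vec.independent (color L ` ?F)"
      using L unfolding nontrivial_coloring_def is_coloring_def by blast
    moreover have "C \<noteq> Side j" "Side j \<noteq> C" "Side i \<noteq> Side (Suc i mod m)" for j
      by (simp_all add: C_def not_sym)
    ultimately show ?thesis
      using C s by (simp add: insert_Diff_if)
  qed
  have "s ! i \<in> range val" if "i < m" for i
  proof (rule in_range_val)
    show "s ! i \<noteq> 0"
      using indep[OF that, of e1] z2_independent3_iff[of e1 "s ! i" "s ! (Suc i mod m)"] by blast
  qed (use indep[OF that] in blast)+
  then have "set s \<subseteq> range val"
    using len by (auto simp: in_set_conv_nth)
  then obtain w where w: "s = map val w"
    by (metis ex_map_conv imageE subsetD)
  have "adj (w ! i) (w ! (Suc i mod m))" if "i < m" for i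
  proof -
    have "s ! i = val (w ! i)" "s ! (Suc i mod m) = val (w ! (Suc i mod m))"
      using that len w by simp_all
    then show ?thesis
      using indep[OF that] independent_val_iff[of "w ! i" "w ! (Suc i mod m)"] by metis
  qed
  then show ?thesis
    using that[of w] s w len by (simp add: cyc_adj_nth)
qed

end

lemma cyc_adj_append_commute: "cyc_adj (u @ v) \<Longrightarrow> cyc_adj (v @ u)"
  by (cases "u = []"; cases "v = []") (auto simp: cyc_adj_def successively_append_iff)

text \<open>The rest of the cycle sees only the first and the last letter of the block.\<close>

lemma cyc_adj_replace_block:
  assumes "cyc_adj (u @ B @ v)" "successively adj B'" "B \<noteq> []" "B' \<noteq> []" "hd B' = hd B" "last B' = last B"
  shows "cyc_adj (u @ B' @ v)"
  using assms by (cases "u = []"; cases "v = []") (simp_all add: cyc_adj_def successively_append_iff)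

text \<open>The action on letters of the linear map from \<open>shear_exists\<close>.\<close>

fun shear :: "bool \<Rightarrow> bool \<Rightarrow> letter \<Rightarrow> letter" where
  "shear p q Z = Z"
| "shear p q (V a b) = V (a \<noteq> p) (b \<noteq> q)"

lemma adj_shear [simp]: "adj (shear p q x) (shear p q y) \<longleftrightarrow> adj x y"
  by (cases x; cases y) auto

lemma shear_id [simp]: "shear False False = id"
proof
  show "shear False False x = id x" for x
    by (cases x) simp_all
qed

lemma successively_shear_rev:
  "successively adj w \<Longrightarrow> successively adj (map (shear p q) (rev w))"
  by (simp add: successively_map) (metis (mono_tags, lifting) adj_commute successively_mono)

lemma cyc_adj_shear: "cyc_adj w \<Longrightarrow> cyc_adj (map (shear p q) w)"
  by (cases "w = []") (simp_all add: cyc_adj_def successively_map last_map hd_map)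

text \<open>Translates the index bounds of a move, the upper one inclusive, into a factorisation of
  the word.\<close>

lemma on_block_append:
  "B \<noteq> [] \<Longrightarrow> on_block (length u) (length u + length B - 1) g (u @ B @ v) = u @ g B @ v"
  by (cases B) (simp_all add: on_block_def)

section \<open>Sector moves as operations on words\<close>

context z2_basis
begin

text \<open>Equal lengths keep the parameter of \<open>sector_equivalent\<close> fixed along a
  chain; the guard spares every later lemma a length hypothesis.\<close>

definition sim :: "letter list \<Rightarrow> letter list \<Rightarrow> bool" where
  "sim w w' \<longleftrightarrow> length w = length w' \<and>
     (length w > 3 \<longrightarrow> sector_equivalent (length w) (prism_coloring w) (prism_coloring w'))"

lemma sim_refl [simp]: "sim w w"
  by (simp add: sim_def sector_equivalent_def)

lemma sim_sym: "sim w w' \<Longrightarrow> sim w' w"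
  by (auto simp: sim_def sector_equivalent_def intro: equivclp_sym)

lemma sim_trans [trans]: "sim w w' \<Longrightarrow> sim w' w'' \<Longrightarrow> sim w w''"
  by (auto simp: sim_def sector_equivalent_def intro: equivclp_trans)

lemma simI:
  assumes "cyc_adj w" "cyc_adj w'" "length w = length w'"
    and "length w > 3 \<Longrightarrow> sector_move (prism_coloring w) (prism_coloring w')"
  shows "sim w w'"
  unfolding sim_def sector_equivalent_def using assms
  by (auto intro!: r_into_equivclp nontrivial_prism_coloring)

lemma sim_rotate: "cyc_adj (u @ v) \<Longrightarrow> sim (u @ v) (v @ u)"
proof (rule simI)
  have "map val (v @ u) = rotate (length (map val u)) (map val (u @ v))"
    unfolding map_append rotate_append ..
  then show "sector_move (prism_coloring (u @ v)) (prism_coloring (v @ u))"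
    by (simp only: sector_move.rotation)
qed (simp_all add: cyc_adj_append_commute)

lemma shear_linear_exists:
  obtains T where "z2_linear T" "bij T" "\<And>x. T (val x) = val (shear p q x)" "T e1 = e1" "T e2 = e2"
proof -
  obtain T where T: "z2_linear T" "bij T"
    "\<And>a b c. T (comb a b c) = comb (a \<noteq> (c \<and> p)) (b \<noteq> (c \<and> q)) c"
    using shear_exists by blast
  have "T (val x) = val (shear p q x)" for x
    by (cases x) (simp_all add: T)
  moreover have "T e1 = e1" "T e2 = e2"
    using T(3)[of True False False] T(3)[of False True False] by (simp_all add: comb_def)
  ultimately show ?thesis
    using that T by blast
qed

text \<open>The linear map fixes \<open>e1\<close> and \<open>e2\<close>, so this
  Davis-Januszkiewicz move keeps the colors of ceiling and floor.\<close>

lemma sim_shear: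
  assumes "cyc_adj w"
  shows "sim w (map (shear p q) w)"
proof (rule simI)
  obtain T where T: "z2_linear T" "bij T" "\<And>x. T (val x) = val (shear p q x)" "T e1 = e1" "T e2 = e2"
    using shear_linear_exists[of p q] by metis
  have "T (e1 + e2) = e1 + e2"
    using T by (metis vec.linear_add)
  moreover have "map T (map val w) = map val (map (shear p q) w)"
    by (simp add: T)
  ultimately show "sector_move (prism_coloring w) (prism_coloring (map (shear p q) w))"
    using sector_move.DJ[OF T(1,2), of e1 "e1 + e2" "map val w"] T(4) by (simp del: map_map)
qed (simp_all add: assms cyc_adj_shear)

text \<open>Equal marks at the ends allow \<open>O31\<close>; for different marks the end colors
  differ by \<open>e1\<close>, which allows \<open>O4\<close> with the linear map that switches
  marks. Reversal and shear together keep both end letters, so only the interior changes.\<close>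

lemma sim_reverse_block:
  assumes cyc: "cyc_adj (u @ V a c # b @ V a' c # v)"
  shows "sim (u @ V a c # b @ V a' c # v)
    (u @ V a c # map (shear (a \<noteq> a') False) (rev b) @ V a' c # v)"
proof -
  define B where "B = V a c # b @ [V a' c]"
  define g where "g = (\<lambda>b. map (shear (a \<noteq> a') False) (rev b))"
  have gB: "g B = V a c # g b @ [V a' c]"
    by (auto simp: g_def B_def)
  let ?w = "u @ B @ v" and ?w' = "u @ g B @ v"
  let ?k = "length u" and ?l = "length u + length B - 1"
  have cycB: "cyc_adj ?w"
    using cyc by (simp add: B_def)
  have "sim ?w ?w'"
  proof (rule simI)
    have "successively adj B"
      using cycB by (simp add: cyc_adj_def successively_append_iff)
    then have "successively adj (g B)"
      unfolding g_def by (rule successively_shear_rev)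
    then show "cyc_adj ?w'"
      by (rule cyc_adj_replace_block[OF cycB]) (simp_all add: gB, simp_all add: B_def)
    have kl: "?k < ?l" "?l < length (map val ?w)"
      and k: "map val ?w ! ?k = val (V a c)" and l: "map val ?w ! ?l = val (V a' c)"
      by (simp_all add: B_def nth_append)
    show "sector_move (prism_coloring ?w) (prism_coloring ?w')"
    proof (cases "a = a'")
      case True
      have "on_block ?k ?l rev (map val ?w) = map val ?w'"
        using on_block_append[of "map val B" "map val u" rev "map val v"] True
        by (simp add: g_def rev_map B_def)
      moreover have "map val ?w ! ?k \<noteq> e1 - (e1 + e2)"
        using comb_inj[of a c True False True False] unfolding k by (simp add: comb_def)
      ultimately show ?thesis
        using sector_move.O31[OF kl, of e1 "e1 + e2"] k l True by simp
    next
      case False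
      then have a': "a' = (\<not> a)"
        by simp
      obtain T where T: "z2_linear T" "\<And>x. T (val x) = val (shear True False x)" "T e2 = e2"
        using shear_linear_exists[of True False] by metis
      have "on_block ?k ?l (\<lambda>b. map T (rev b)) (map val ?w) = map val ?w'"
        using on_block_append[of "map val B" "map val u" "\<lambda>b. map T (rev b)" "map val v"] a'
        by (simp add: g_def rev_map B_def T del: val.simps)
      moreover have "map val ?w ! ?k - map val ?w ! ?l \<in> {e1, e1 + e2}"
        unfolding k l using a' by (cases a; cases c) (simp_all add: comb_def add_ac)
      ultimately show ?thesis
        using sector_move.O4[OF kl _ T(1), of e1 "e1 + e2"] k l T a' by (simp del: val.simps)
    qed
  qed (use cycB in \<open>simp_all add: gB B_def g_def\<close>)
  then show ?thesis
    by (simp add: gB, simp add: B_def g_def)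
qed

text \<open>On letters the map of \<open>O21\<close> is \<open>shear False True\<close>:
  \<open>val Z\<close> lies in the span of \<open>e1\<close> and \<open>e2\<close>, and
  \<open>val (V a b)\<close> does not.\<close>

lemma sim_flip_block:
  assumes cyc: "cyc_adj (u @ Z # b @ Z # v)"
  shows "sim (u @ Z # b @ Z # v) (u @ Z # map (shear False True) b @ Z # v)"
proof -
  define B where "B = Z # b @ [Z]"
  define g where "g = map (shear False True)"
  have gB: "g B = Z # g b @ [Z]"
    by (auto simp: g_def B_def)
  let ?w = "u @ B @ v" and ?w' = "u @ g B @ v"
  let ?k = "length u" and ?l = "length u + length B - 1"
  define \<phi> where "\<phi> = (\<lambda>v. if v \<in> vec.span {e1, e1 - (e1 + e2)} then v else v + (e1 - (e1 + e2)))"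
  have cycB: "cyc_adj ?w"
    using cyc by (simp add: B_def)
  have "sim ?w ?w'"
  proof (rule simI)
    have "successively adj B"
      using cycB by (simp add: cyc_adj_def successively_append_iff)
    then have "successively adj (g B)"
      by (simp add: g_def successively_map)
    then show "cyc_adj ?w'"
      by (rule cyc_adj_replace_block[OF cycB]) (simp_all add: gB, simp_all add: B_def)
    have kl: "?k < ?l" "?l < length (map val ?w)"
      and k: "map val ?w ! ?k = e1 - (e1 + e2)" and l: "map val ?w ! ?l = e1 - (e1 + e2)"
      by (simp_all add: B_def nth_append comb_def)
    have span: "v \<in> vec.span {e1, e1 - (e1 + e2)} \<longleftrightarrow> (\<exists>p q. v = comb p q False)" for v
      by (simp add: z2_span_insert ex_bool_eq z2_add_eq_0_iff add.assoc comb_def) blast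
    have \<phi>: "\<phi> (val x) = val (shear False True x)" for x
    proof (cases x)
      case (V a b)
      then have "val x \<notin> vec.span {e1, e1 - (e1 + e2)}"
        unfolding span by (simp add: comb_inj)
      moreover have "val x + (e1 - (e1 + e2)) = val (shear False True x)"
        unfolding V by (cases a; cases b) (simp_all add: comb_def add_ac)
      ultimately show ?thesis
        by (simp only: \<phi>_def if_False)
    next
      case Z
      then have "val x \<in> vec.span {e1, e1 - (e1 + e2)}"
        unfolding span by auto
      with Z show ?thesis
        by (simp only: \<phi>_def if_True shear.simps)
    qed
    have "on_block ?k ?l (map \<phi>) (map val ?w) = map val ?w'"
      using on_block_append[of "map val B" "map val u" "map \<phi>" "map val v"]
      by (simp add: g_def B_def \<phi> del: val.simps)
    then show "sector_move (prism_coloring ?w) (prism_coloring ?w')"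
      using sector_move.O21[OF kl k l] by (simp only: \<phi>_def)
  qed (use cycB in \<open>simp_all add: gB B_def g_def\<close>)
  then show ?thesis
    by (simp add: gB, simp add: B_def g_def)
qed

end


section \<open>Words as sequences of segments\<close>

fun alt :: "bool \<Rightarrow> bool \<Rightarrow> nat \<Rightarrow> letter list" where
  "alt a b 0 = []"
| "alt a b (Suc k) = V a b # alt a (\<not> b) k"

text \<open>A segment \<open>(a, b, k)\<close> has \<open>k + 1\<close> letters besides the leading \<open>Z\<close>, so that it is never empty.\<close>

fun word :: "(bool \<times> bool \<times> nat) list \<Rightarrow> letter list" where
  "word [] = []"
| "word ((a, b, k) # ss) = Z # alt a b (Suc k) @ word ss"

lemma alt_Suc_right: "alt a b (Suc k) = alt a b k @ [V a (b \<noteq> odd k)]"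
proof (induction k arbitrary: b)
  case (Suc k)
  have "alt a b (Suc (Suc k)) = V a b # alt a (\<not> b) (Suc k)"
    by (rule alt.simps)
  also have "\<dots> = V a b # alt a (\<not> b) k @ [V a ((\<not> b) \<noteq> odd k)]"
    by (simp only: Suc)
  also have "\<dots> = alt a b (Suc k) @ [V a (b \<noteq> odd (Suc k))]"
    by simp
  finally show ?case .
qed simp

lemma length_alt [simp]: "length (alt a b k) = k"
  by (induction k arbitrary: b) auto

lemma map_shear_alt [simp]: "map (shear p q) (alt a b k) = alt (a \<noteq> p) (b \<noteq> q) k"
proof (induction k arbitrary: b)
  case (Suc k)
  have "(b = q) = ((\<not> b) \<noteq> q)"
    by blast
  with Suc show ?case
    by simp
qed simp

lemma successively_alt [simp]: "successively adj (alt a b k)"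
proof (induction k arbitrary: b)
  case (Suc k)
  show ?case
    using Suc[of "\<not> b"] by (cases k) simp_all
qed simp

lemma rev_alt: "rev (alt a b k) = alt a (b \<noteq> even k) k"
proof (induction k arbitrary: b)
  case (Suc k)
  have "rev (alt a b (Suc k)) = alt a ((\<not> b) \<noteq> even k) k @ [V a b]"
    using Suc[of "\<not> b"] by simp
  also have "\<dots> = alt a (b \<noteq> even (Suc k)) (Suc k)"
    unfolding alt_Suc_right by (cases "even k") auto
  finally show ?case .
qed simp

lemma word_append [simp]: "word (ss @ ts) = word ss @ word ts"
  by (induction ss rule: word.induct) auto

lemma word_eq_Nil_iff [simp]: "word ss = [] \<longleftrightarrow> ss = []"
  by (cases ss) auto

lemma hd_word: "ss \<noteq> [] \<Longrightarrow> hd (word ss) = Z"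
  by (cases ss) auto

lemma last_word: "ss \<noteq> [] \<Longrightarrow> last (word ss) \<noteq> Z"
proof (induction ss rule: word.induct)
  case (2 a b k ss)
  have "last (alt a b (Suc k)) \<noteq> Z"
    by (simp only: alt_Suc_right last_snoc) simp
  with 2 show ?case
    by (cases "ss = []") simp_all
qed simp

lemma adj_Z: "x \<noteq> Z \<Longrightarrow> adj x Z" "x \<noteq> Z \<Longrightarrow> adj Z x"
  by (cases x; simp)+

lemma successively_word: "successively adj (word ss)"
proof (induction ss rule: word.induct)
  case (2 a b k ss)
  have "last (alt a b (Suc k)) \<noteq> Z"
    by (simp only: alt_Suc_right last_snoc) simp
  moreover have "successively adj (Z # alt a b (Suc k))"
    using successively_alt[of a b "Suc k"] by simp
  ultimately have "successively adj ((Z # alt a b (Suc k)) @ word ss)"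
    using 2 hd_word[of ss] unfolding successively_append_iff
    by (cases "ss = []") (simp_all add: adj_Z)
  then show ?case
    by simp
qed simp

lemma cyc_adj_word [simp]: "cyc_adj (word ss)"
  unfolding cyc_adj_def using successively_word[of ss] hd_word[of ss] last_word[of ss] by (auto simp: adj_Z)

text \<open>Reading from the right, a letter other than \<open>Z\<close> extends the leading run,
  and a \<open>Z\<close> closes the run into a segment. The condition on the last letter keeps the
  final segment nonempty.\<close>

lemma alt_word_decomposition:
  "successively adj w \<Longrightarrow> w = [] \<or> last w \<noteq> Z \<Longrightarrow> \<exists>a b k ss. w = alt a b k @ word ss"
proof (induction w)
  case Nil
  then show ?case
    by (metis alt.simps(1) append_Nil word.simps(1))
next
  case (Cons x w)
  then obtain a b k ss where w: "w = alt a b k @ word ss"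
    by (auto simp: successively_Cons split: if_splits)
  show ?case
  proof (cases x)
    case Z
    with Cons.prems have "w \<noteq> []" "adj Z (hd w)"
      by (auto simp: successively_Cons)
    \<comment> \<open>With an empty run the rest would begin with \<open>Z\<close>, next to another
      \<open>Z\<close>.\<close>
    then have "k \<noteq> 0"
      using w hd_word[of ss] by (cases k) auto
    then obtain k' where "k = Suc k'"
      by (cases k) auto
    then have "x # w = alt a b 0 @ word ((a, b, k') # ss)"
      using w Z by simp
    then show ?thesis
      by blast
  next
    case x: (V a' b')
    show ?thesis
    proof (cases k)
      case 0
      then have "x # w = alt a' b' (Suc 0) @ word ss"
        using w x by simp
      then show ?thesis
        by blast
    next
      case (Suc k')
      then have "adj (V a' b') (V a b)"
        using Cons.prems w x by simp
      then have "x # w = alt a' b' (Suc k) @ word ss"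
        using w x by simp
      then show ?thesis
        by blast
    qed
  qed
qed

text \<open>Recovers the marks from the sequence of mark changes; \<open>deltas\<close> below is the inverse.\<close>

fun acc :: "bool \<Rightarrow> bool list \<Rightarrow> bool list" where
  "acc a [] = []"
| "acc a (d # ds) = (a \<noteq> d) # acc (a \<noteq> d) ds"

lemma length_acc [simp]: "length (acc a ds) = length ds"
  by (induction ds arbitrary: a) auto

lemma acc_append: "acc a (ds @ es) = acc a ds @ acc (a \<noteq> odd (count_list ds True)) es"
proof (induction ds arbitrary: a)
  case (Cons d ds)
  have "((a \<noteq> d) \<noteq> odd (count_list ds True)) = (a \<noteq> odd (count_list (d # ds) True))"
    by (cases d) auto
  then show ?case
    using Cons[of "a \<noteq> d"] by (simp only: acc.simps append_Cons)
qed simp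

lemma acc_eq_Nil_iff [simp]: "acc a ds = [] \<longleftrightarrow> ds = []"
  by (cases ds) auto

text \<open>Each \<open>True\<close> flips the mark, so only the parity of their number
  matters.\<close>

lemma last_acc: "ds \<noteq> [] \<Longrightarrow> last (acc a ds) = (a \<noteq> odd (count_list ds True))"
proof (induction ds arbitrary: a)
  case (Cons d ds)
  have "((a \<noteq> d) \<noteq> odd (count_list ds True)) = (a \<noteq> odd (count_list (d # ds) True))"
    by (cases d) auto
  then show ?case
    using Cons.IH[of "a \<noteq> d"] by (cases "ds = []") simp_all
qed simp



text \<open>Phases of segments can be switched freely by \<open>sim_flip_phase\<close>, so one
  representative suffices.\<close>

abbreviation plain :: "bool \<Rightarrow> nat \<Rightarrow> bool \<times> bool \<times> nat" where
  "plain a k \<equiv> (a, False, k)"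

declare word.simps [simp del] word_append [simp del]

lemmas word_simps = word.simps word_append

section \<open>Sector-equivalence of segment sequences\<close>

context z2_basis
begin

lemma sim_word_rotate: "sim (word (ss @ ts)) (word (ts @ ss))"
  using sim_rotate[of "word ss" "word ts"] cyc_adj_word[of "ss @ ts"] by (simp add: word_append)

text \<open>After rotating the segment to the front, the leading \<open>Z\<close> of the next
  segment closes a block for \<open>O21\<close>. A single segment has no second \<open>Z\<close>;
  there a shear of the whole word does the same.\<close>

lemma sim_flip_phase: "sim (word (us @ (a, b, k) # vs)) (word (us @ (a, b', k) # vs))"
proof (cases "b = b'")
  case False
  then have b': "b' = (\<not> b)"
    by simp
  have "sim (word ((a, b, k) # vs @ us)) (word ((a, b', k) # vs @ us))"
  proof (cases "vs @ us")
    case Nil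
    then show ?thesis
      using sim_shear[OF cyc_adj_word[of "[(a, b, k)]"], of False True]
        by (simp add: b' word_simps)
  next
    case (Cons s ss)
    obtain a2 b2 k2 where s: "s = (a2, b2, k2)"
      by (cases s)
    show ?thesis
      using sim_flip_block[of "[]" "alt a b (Suc k)" "alt a2 b2 (Suc k2) @ word ss"]
        cyc_adj_word[of "(a, b, k) # s # ss"]
      unfolding Cons s b' by (simp add: word_simps)
  qed
  from sim_trans[OF sim_trans[OF sim_word_rotate[of us "(a, b, k) # vs"]] sim_word_rotate[of "(a, b', k) # vs" us]] this
  show ?thesis
    by simp
qed simp

text \<open>As \<open>a1 \<noteq> a3\<close>, the mark changes at exactly one of the two
  \<open>Z\<close> around the middle segment. Reversing a block that contains both moves the change
  to the other one.\<close>

lemma sim_flip_mark: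
  assumes "a1 \<noteq> a3"
  shows "sim (word (us @ (a1, b1, k1) # (a2, b2, k2) # (a3, b3, k3) # vs))
    (word (us @ (a1, b1, k1) # (\<not> a2, b2, k2) # (a3, b3, k3) # vs))"
proof -
  \<comment> \<open>The phase of the last letter of the first segment; the third segment is given
    the same phase, so that the ends of the block agree in it.\<close>
  define c where "c = (b1 \<noteq> odd k1)"
  \<comment> \<open>The initial phase of the middle segment once it is reversed.\<close>
  define b' where "b' = (b2 \<noteq> even (Suc k2))"
  let ?u = "word us @ Z # alt a1 b1 k1" and ?v = "alt a3 (\<not> c) k3 @ word vs"
  have decomp: "word (us @ (a1, b1, k1) # (a, b, k2) # (a3, c, k3) # vs) =
      ?u @ V a1 c # (Z # alt a b (Suc k2) @ [Z]) @ V a3 c # ?v" for a b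
    using alt_Suc_right[of a1 b1 k1] by (simp add: c_def word_simps)
  have "sim (word (us @ (a1, b1, k1) # (a2, b2, k2) # (a3, b3, k3) # vs))
      (word (us @ (a1, b1, k1) # (a2, b2, k2) # (a3, c, k3) # vs))"
    using sim_flip_phase[of "us @ [(a1, b1, k1), (a2, b2, k2)]"] by simp
  also have "sim \<dots> (word (us @ (a1, b1, k1) # (\<not> a2, b', k2) # (a3, c, k3) # vs))"
  proof -
    let ?M = "Z # alt a2 b2 (Suc k2) @ [Z]"
    have "map (shear (a1 \<noteq> a3) False) (rev ?M) = Z # map (shear True False) (rev (alt a2 b2 (Suc k2))) @ [Z]"
      using assms by (simp del: alt.simps)
    also have "\<dots> = Z # alt (\<not> a2) b' (Suc k2) @ [Z]"
      unfolding rev_alt map_shear_alt b'_def by simp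
    finally have M: "map (shear (a1 \<noteq> a3) False) (rev ?M) = Z # alt (\<not> a2) b' (Suc k2) @ [Z]" .
    have "sim (?u @ V a1 c # ?M @ V a3 c # ?v) (?u @ V a1 c # map (shear (a1 \<noteq> a3) False) (rev ?M) @ V a3 c # ?v)"
      by (rule sim_reverse_block) (simp only: decomp[symmetric] cyc_adj_word)
    then show ?thesis
      by (simp only: decomp M)
  qed
  also have "sim \<dots> (word (us @ (a1, b1, k1) # (\<not> a2, b2, k2) # (a3, c, k3) # vs))"
    using sim_flip_phase[of "us @ [(a1, b1, k1)]"] by simp
  also have "sim \<dots> (word (us @ (a1, b1, k1) # (\<not> a2, b2, k2) # (a3, b3, k3) # vs))"
    using sim_flip_phase[of "us @ [(a1, b1, k1), (\<not> a2, b2, k2)]"] by simp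
  finally show ?thesis .
qed

text \<open>The block runs from the last letter of the first segment to the second letter of the
  second one, whose phase is chosen to match. Reversal moves the \<open>Z\<close> inside past one
  letter, and the shear gives that letter the mark \<open>a1\<close>.\<close>

lemma sim_shift:
  "sim (word (us @ (a1, b1, k1) # (a2, b2, Suc k2) # vs)) (word (us @ (a1, b1, Suc k1) # (a2, b2, k2) # vs))"
proof -
  define c where "c = (b1 \<noteq> odd k1)"
  let ?u = "word us @ Z # alt a1 b1 k1" and ?v = "alt a2 (\<not> c) k2 @ word vs"
  have decomp: "word (us @ (a1, b1, k1) # (a2, \<not> c, Suc k2) # vs) =
      ?u @ V a1 c # [Z, V a2 (\<not> c)] @ V a2 c # ?v"
    using alt_Suc_right[of a1 b1 k1] by (simp add: c_def word_simps)
  have "sim (word (us @ (a1, b1, k1) # (a2, b2, Suc k2) # vs)) (word (us @ (a1, b1, k1) # (a2, \<not> c, Suc k2) # vs))"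
    using sim_flip_phase[of "us @ [(a1, b1, k1)]"] by simp
  also have "sim \<dots> (?u @ V a1 c # map (shear (a1 \<noteq> a2) False) (rev [Z, V a2 (\<not> c)]) @ V a2 c # ?v)"
    unfolding decomp by (rule sim_reverse_block) (simp only: decomp[symmetric] cyc_adj_word)
  also have "\<dots> = word (us @ (a1, b1, Suc k1) # (a2, c, k2) # vs)"
  proof -
    have "alt a1 b1 (Suc (Suc k1)) = alt a1 b1 k1 @ [V a1 c, V a1 (\<not> c)]"
      by (simp only: alt_Suc_right c_def) simp
    moreover have "(a2 \<noteq> (a1 \<noteq> a2)) = a1"
      by blast
    ultimately show ?thesis
      by (simp add: word_simps)
  qed
  also have "sim \<dots> (word (us @ (a1, b1, Suc k1) # (a2, b2, k2) # vs))"
    using sim_flip_phase[of "us @ [(a1, b1, Suc k1)]"] by simp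
  finally show ?thesis .
qed

lemma sim_shift_all:
  "sim (word (us @ (a1, b1, k1) # (a2, b2, k2) # vs)) (word (us @ (a1, b1, 0) # (a2, b2, k1 + k2) # vs))"
proof (induction k1 arbitrary: k2)
  case (Suc k1)
  show ?case
    using sim_trans[OF sim_sym[OF sim_shift[of us a1 b1 k1 a2 b2 k2 vs]] Suc[of "Suc k2"]] by simp
qed simp

lemma sim_plain:
  "sim (word (us @ ss)) (word (us @ map (\<lambda>(a, b, k). plain a k) ss))"
proof (induction ss arbitrary: us)
  case (Cons s ss)
  obtain a b k where s: "s = (a, b, k)"
    by (cases s)
  have "sim (word (us @ s # ss)) (word (us @ plain a k # ss))"
    unfolding s by (rule sim_flip_phase)
  also have "sim \<dots> (word (us @ map (\<lambda>(a, b, k). plain a k) (s # ss)))"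
    using Cons[of "us @ [plain a k]"] by (simp add: s)
  finally show ?case .
qed simp

text \<open>From left to right each segment passes its excess length to the next; \<open>us\<close>
  is general so that it can absorb the segments already emptied.\<close>

lemma sim_collect:
  assumes "length ks = length as" "as \<noteq> []"
  shows "sim (word (us @ map2 plain as ks)) (word (us @ map2 plain as (replicate (length as - 1) 0 @ [sum_list ks])))"
  using assms
proof (induction as arbitrary: us ks)
  case (Cons a as)
  then obtain k ks' where ks: "ks = k # ks'" "length ks' = length as"
    by (cases ks) auto
  show ?case
  proof (cases as)
    case (Cons a' as')
    then obtain k' ks'' where ks': "ks' = k' # ks''" "length ks'' = length as'"
      using ks by (cases ks') auto
    have "sim (word (us @ map2 plain (a # as) ks)) (word (us @ plain a 0 # map2 plain as ((k + k') # ks'')))"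
      using sim_shift_all[of us a False k a' False k' "map2 plain as' ks''"] by (simp add: ks ks' Cons)
    also have "sim \<dots> (word ((us @ [plain a 0]) @ map2 plain as (replicate (length as - 1) 0 @ [sum_list ((k + k') # ks'')])))"
      using Cons.IH[of "(k + k') # ks''" "us @ [plain a 0]"] ks' Cons by simp
    finally show ?thesis
      by (simp add: ks ks' Cons add.assoc)
  qed (use ks in simp)
qed simp

text \<open>Swapping \<open>x \<noteq> y\<close> alters only the mark of the segment between the two
  changes. The segments around it have marks \<open>s\<close> and \<open>\<not> s\<close>, as
  \<open>sim_flip_mark\<close> requires.\<close>

lemma sim_swap:
  assumes even: "even (count_list (us @ x # y # vs) True)" and len: "length ks = length (us @ x # y # vs)"
  shows "sim (word (map2 plain (acc a (us @ x # y # vs)) ks)) (word (map2 plain (acc a (us @ y # x # vs)) ks))"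
proof (cases "x = y")
  case False
  then have y: "y = (\<not> x)"
    by simp
  define s where "s = (a \<noteq> odd (count_list us True))"
  define ks1 where "ks1 = take (length us) ks"
  obtain k2 k3 ks2 where "drop (length us) ks = k2 # k3 # ks2"
  proof -
    have "length (drop (length us) ks) = Suc (Suc (length vs))"
      using len by simp
    then show ?thesis
      using that by (metis length_Suc_conv)
  qed
  then have ks: "ks = ks1 @ k2 # k3 # ks2" "length ks1 = length us"
    using len append_take_drop_id[of "length us" ks] by (simp_all add: ks1_def)
  have expand: "map2 plain (acc a (us @ z # (\<not> z) # vs)) ks =
      map2 plain (acc a us) ks1 @ plain (s \<noteq> z) k2 # plain (\<not> s) k3 # map2 plain (acc (\<not> s) vs) ks2" for z
  proof -
    have eq: "((s \<noteq> z) \<noteq> (\<not> z)) = (\<not> s)"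
      by blast
    have "acc a (us @ z # (\<not> z) # vs) = acc a us @ (s \<noteq> z) # (\<not> s) # acc (\<not> s) vs"
      by (simp only: acc_append acc.simps eq flip: s_def)
    then show ?thesis
      using ks by simp
  qed
  let ?R = "map2 plain (acc (\<not> s) vs) ks2"
  have xy: "map2 plain (acc a (us @ x # y # vs)) ks = map2 plain (acc a us) ks1 @ plain (s \<noteq> x) k2 # plain (\<not> s) k3 # ?R"
    using expand[of x] by (simp only: y)
  have yx: "map2 plain (acc a (us @ y # x # vs)) ks = map2 plain (acc a us) ks1 @ plain (s \<noteq> y) k2 # plain (\<not> s) k3 # ?R"
    using expand[of y] by (simp only: y not_not)
  have flip: "(\<not> (s \<noteq> x)) = (s \<noteq> y)"
    using y by blast
  show ?thesis
    unfolding xy yx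
  proof (cases us rule: rev_cases)
    case (snoc us' d)
    have ne: "acc a us \<noteq> []" and last: "last (acc a us) = s"
      using last_acc[of us a] snoc by (simp_all add: s_def)
    obtain as where as: "acc a us = as @ [s]"
      using append_butlast_last_id[OF ne, symmetric] unfolding last by blast
    obtain ks1' k1 where ks1: "ks1 = ks1' @ [k1]"
      using ks(2) snoc by (cases ks1 rule: rev_cases) auto
    then have "length ks1' = length as"
      using ks(2) arg_cong[OF as, of length] by simp
    have prefix: "map2 plain (acc a us) ks1 = map2 plain as ks1' @ [plain s k1]"
      using ks1 as \<open>length ks1' = length as\<close> by simp
    show "sim (word (map2 plain (acc a us) ks1 @ plain (s \<noteq> x) k2 # plain (\<not> s) k3 # ?R))
      (word (map2 plain (acc a us) ks1 @ plain (s \<noteq> y) k2 # plain (\<not> s) k3 # ?R))"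
      unfolding flip[symmetric] prefix append.assoc append_Cons append_Nil by (rule sim_flip_mark) simp
  next
    case Nil
    then have s: "s = a"
      by (simp add: s_def)
    \<comment> \<open>With no earlier segment in the list, the cyclic predecessor is the last one;
      the even total gives it the mark \<open>s\<close>.\<close>
    have odd: "odd (count_list vs True)"
      using even y Nil by (cases x) auto
    then have "vs \<noteq> []"
      by auto
    then have ne: "acc (\<not> s) vs \<noteq> []" and last: "last (acc (\<not> s) vs) = s"
      using last_acc[of vs "\<not> s"] odd by simp_all
    obtain as where as: "acc (\<not> s) vs = as @ [s]"
      using append_butlast_last_id[OF ne, symmetric] unfolding last by blast
    have ks2_len: "length ks2 = length vs"
      using len ks by simp
    then obtain ks2' k1 where ks2: "ks2 = ks2' @ [k1]"
      using \<open>vs \<noteq> []\<close> by (cases ks2 rule: rev_cases) auto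
    then have "length ks2' = length as"
      using ks2_len arg_cong[OF as, of length] by simp
    then have rest: "?R = map2 plain as ks2' @ [plain s k1]"
      using ks2 as by simp
    let ?Q = "map2 plain as ks2'"
    have "sim (word ((plain (s \<noteq> x) k2 # plain (\<not> s) k3 # ?Q) @ [plain s k1]))
      (word ([plain s k1] @ (plain (s \<noteq> x) k2 # plain (\<not> s) k3 # ?Q)))"
      by (rule sim_word_rotate)
    also have "sim \<dots> (word ([plain s k1] @ plain (s \<noteq> y) k2 # plain (\<not> s) k3 # ?Q))"
      unfolding flip[symmetric] append_Cons append_Nil
      by (rule sim_flip_mark[of _ _ "[]", unfolded append_Nil]) simp
    also have "sim \<dots> (word ((plain (s \<noteq> y) k2 # plain (\<not> s) k3 # ?Q) @ [plain s k1]))"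
      by (rule sim_word_rotate)
    finally show "sim (word (map2 plain (acc a us) ks1 @ plain (s \<noteq> x) k2 # plain (\<not> s) k3 # ?R))
      (word (map2 plain (acc a us) ks1 @ plain (s \<noteq> y) k2 # plain (\<not> s) k3 # ?R))"
      unfolding rest using Nil by simp
  qed
qed simp

lemma sim_move_right:
  assumes "even (count_list (us @ x # vs @ ws) True)" and "length ks = length (us @ x # vs @ ws)"
  shows "sim (word (map2 plain (acc a (us @ x # vs @ ws)) ks)) (word (map2 plain (acc a (us @ vs @ x # ws)) ks))"
  using assms
proof (induction vs arbitrary: us)
  case (Cons y vs)
  have "sim (word (map2 plain (acc a (us @ x # y # vs @ ws)) ks)) (word (map2 plain (acc a (us @ y # x # vs @ ws)) ks))"
    using Cons.prems by (intro sim_swap) simp_all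
  also have "sim \<dots> (word (map2 plain (acc a ((us @ [y]) @ vs @ x # ws)) ks))"
    using Cons.IH[of "us @ [y]"] Cons.prems by simp
  finally show ?case
    by simp
qed simp

text \<open>Insertion sort: the tail is sorted behind the prefix \<open>us @ [d]\<close>, then a
  \<open>False\<close> in front moves right past all \<open>True\<close> entries.\<close>

lemma sim_sort:
  assumes "even (count_list (us @ ds) True)" and "length ks = length (us @ ds)"
  shows "sim (word (map2 plain (acc a (us @ ds)) ks))
    (word (map2 plain (acc a (us @ replicate (count_list ds True) True @ replicate (count_list ds False) False)) ks))"
  using assms
proof (induction ds arbitrary: us)
  case (Cons d ds)
  let ?T = "replicate (count_list ds True) True" and ?F = "replicate (count_list ds False) False"
  have len: "count_list ds True + count_list ds False = length ds"
    by (induction ds) auto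
  have cnt: "count_list (replicate k b) True = (if b then k else 0)" for k b
    by (induction k) auto
  have "sim (word (map2 plain (acc a (us @ d # ds)) ks)) (word (map2 plain (acc a (us @ d # ?T @ ?F)) ks))"
    using Cons.IH[of "us @ [d]"] Cons.prems by simp
  also have "sim \<dots> (word (map2 plain (acc a (us @ replicate (count_list (d # ds) True) True @
      replicate (count_list (d # ds) False) False)) ks))"
  proof (cases d)
    case False
    have "sim (word (map2 plain (acc a (us @ False # ?T @ ?F)) ks)) (word (map2 plain (acc a (us @ ?T @ False # ?F)) ks))"
      using Cons.prems len False by (intro sim_move_right) (simp_all add: cnt)
    then show ?thesis
      using False by simp
  qed simp
  finally show ?case .
qed simp

end


section \<open>Counting mark changes\<close>

text \<open>\<open>mark Z\<close> is an unspecified value; it has no influence on words with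
  \<open>successively adj\<close>, where no neighbour of a \<open>Z\<close> is a
  \<open>Z\<close>.\<close>

fun turns :: "letter list \<Rightarrow> nat" where
  "turns (x # y # z # w) = of_bool (y = Z \<and> mark x \<noteq> mark z) + turns (y # z # w)"
| "turns _ = 0"

text \<open>The two parts overlap in two letters, so each triple of consecutive letters lies in
  exactly one of them.\<close>

lemma turns_split: "turns (u @ x # y # v) = turns (u @ [x, y]) + turns (x # y # v)"
proof (induction u rule: induct_list012)
  case (3 a b u)
  then show ?case
    by (cases u) simp_all
qed simp_all

lemma turns_conv_card:
  "turns w = card {i. Suc (Suc i) < length w \<and> w ! Suc i = Z \<and> mark (w ! i) \<noteq> mark (w ! Suc (Suc i))}"
proof (induction w rule: turns.induct)
  case (1 x y z w)
  let ?S = "\<lambda>w. {i. Suc (Suc i) < length w \<and> w ! Suc i = Z \<and> mark (w ! i) \<noteq> mark (w ! Suc (Suc i))}"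
  have fin: "finite (?S u)" for u
    by (rule finite_subset[of _ "{..<length u}"]) auto
  have "i \<in> ?S (x # y # z # w) \<longleftrightarrow> i = 0 \<and> y = Z \<and> mark x \<noteq> mark z \<or> i \<in> Suc ` ?S (y # z # w)" for i
    by (cases i) (auto simp: image_iff)
  then have "?S (x # y # z # w) = (if y = Z \<and> mark x \<noteq> mark z then {0} else {}) \<union> Suc ` ?S (y # z # w)"
    by (auto split: if_splits)
  then show ?case
    using 1 fin[of "y # z # w"] by (simp add: card_image)
qed simp_all

definition cyc_turns :: "letter list \<Rightarrow> nat" where
  "cyc_turns w = turns (last w # w @ [hd w])"

text \<open>Cut at the seam between \<open>u\<close> and \<open>v\<close>, both cyclic words give
  the same two pieces.\<close>

lemma cyc_turns_append_commute: "cyc_turns (u @ v) = cyc_turns (v @ u)"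
proof (cases "u = [] \<or> v = []")
  case False
  obtain x u' y v' where u: "u = u' @ [x]" and v: "v = y # v'"
    using False by (metis list.exhaust rev_exhaust)
  obtain x' u'' where u2: "u = x' # u''"
    using False by (cases u) auto
  obtain y' v'' where v2: "v = v'' @ [y']"
    using False by (cases v rule: rev_cases) auto
  have "cyc_turns (u @ v) = turns (y' # u @ v @ [x'])"
    by (simp add: cyc_turns_def u2 v2)
  also have "\<dots> = turns (y' # u @ [y]) + turns (x # v @ [x'])"
    using turns_split[of "y' # u'" x y "v' @ [x']"] by (simp add: u v)
  moreover have "cyc_turns (v @ u) = turns (x # v @ u @ [y])"
    by (simp add: cyc_turns_def u v)
  moreover have "turns (x # v @ u @ [y]) = turns (x # v @ [x']) + turns (y' # u @ [y])"
    using turns_split[of "x # v''" y' x' "u'' @ [y]"] by (simp add: u2 v2)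
  ultimately show ?thesis
    by simp
qed auto

lemma turns_V: "turns (V a b # w) = turns (V a c # w)"
  by (cases w; cases "tl w") auto

lemma turns_alt: "turns (V a b # alt a b' k @ w) = turns (V a c # w)"
proof (induction k arbitrary: b b')
  case 0
  then show ?case
    by (simp add: turns_V[of a b w c])
next
  case (Suc k)
  have "turns (V a b # alt a b' (Suc k) @ w) = turns (V a b' # alt a (\<not> b') k @ w)"
    by (cases "alt a (\<not> b') k @ w") simp_all
  then show ?case
    using Suc[of b' "\<not> b'"] by simp
qed

fun deltas :: "bool \<Rightarrow> bool list \<Rightarrow> bool list" where
  "deltas a [] = []"
| "deltas a (x # xs) = (a \<noteq> x) # deltas x xs"

lemma acc_deltas [simp]: "acc a (deltas a xs) = xs"
proof (induction xs arbitrary: a)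
  case (Cons x xs)
  have "(a \<noteq> (a \<noteq> x)) = x"
    by blast
  with Cons show ?case
    by (simp only: deltas.simps acc.simps)
qed simp

lemma length_deltas [simp]: "length (deltas a xs) = length xs"
  by (induction xs arbitrary: a) auto

text \<open>\<open>V a c\<close> and the final \<open>Z\<close> stand for the letters before and
  after the word. Only the leading \<open>Z\<close> of a segment can be a turn.\<close>

lemma turns_word: "turns (V a c # word ss @ [Z]) = count_list (deltas a (map fst ss)) True"
proof (induction ss arbitrary: a c)
  case (Cons s ss)
  obtain a' b k where s: "s = (a', b, k)"
    by (cases s)
  have "turns (V a c # word (s # ss) @ [Z]) = of_bool (a \<noteq> a') + turns (V a' b # alt a' (\<not> b) k @ word ss @ [Z])"
    by (cases "alt a' (\<not> b) k @ word ss @ [Z]") (simp_all add: s word_simps)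
  also have "\<dots> = of_bool (a \<noteq> a') + count_list (deltas a' (map fst ss)) True"
    by (simp only: turns_alt[of a' b "\<not> b" k "word ss @ [Z]" b] Cons)
  finally show ?case
    by (simp add: s)
qed (simp add: word_simps)

lemma last_word_eq: "ss \<noteq> [] \<Longrightarrow> \<exists>c. last (word ss) = V (last (map fst ss)) c"
proof (induction ss)
  case (Cons s ss)
  obtain a b k where s: "s = (a, b, k)"
    by (cases s)
  show ?case
  proof (cases "ss = []")
    case True
    have "last (word [s]) = last (alt a b (Suc k))"
      by (simp add: s word_simps)
    then show ?thesis
      using True s by (simp only: alt_Suc_right last_snoc) simp
  next
    case False
    then have "last (word (s # ss)) = last (word ss)"
      by (simp add: s word_simps)
    then show ?thesis
      using Cons False by simp
  qed
qed simp

lemma cyc_turns_word: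
  assumes "ss \<noteq> []"
  shows "cyc_turns (word ss) = count_list (deltas (last (map fst ss)) (map fst ss)) True"
  using last_word_eq[OF assms] turns_word hd_word[OF assms] by (auto simp: cyc_turns_def)

text \<open>Starting from the last mark, the changes lead around the cycle back to it.\<close>

lemma even_count_deltas:
  assumes "xs \<noteq> []"
  shows "even (count_list (deltas (last xs) xs) True)"
  using last_acc[of "deltas (last xs) xs" "last xs"] assms by (auto simp flip: length_greater_0_conv)

lemma count_list_alt_Z [simp]: "count_list (alt a b k) Z = 0"
  by (induction k arbitrary: b) auto

lemma count_list_word_Z: "count_list (word ss) Z = length ss"
  by (induction ss rule: word.induct) (simp_all add: word_simps)

lemma length_word: "length (word ss) = sum_list (map (\<lambda>(a, b, k). k) ss) + 2 * length ss"
  by (induction ss rule: word.induct) (simp_all add: word_simps)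

lemma map_shear_word: "map (shear p False) (word (map2 plain as ks)) = word (map2 plain (map (\<lambda>a. a \<noteq> p) as) ks)"
proof (induction as arbitrary: ks)
  case (Cons a as)
  show ?case
  proof (cases ks)
    case (Cons k ks')
    then show ?thesis
      using Cons.IH[of ks'] by (simp add: word_simps)
  qed (simp add: word_simps)
qed (simp add: word_simps)

lemma acc_flip: "map (\<lambda>a. a \<noteq> p) (acc a ds) = acc (a \<noteq> p) ds"
proof (induction ds arbitrary: a)
  case (Cons d ds)
  have "((a \<noteq> d) \<noteq> p) = ((a \<noteq> p) \<noteq> d)"
    by blast
  then show ?case
    using Cons[of "a \<noteq> d"] by (simp only: acc.simps list.map)
qed simp

lemma alt_conv_map: "alt a b k = map (\<lambda>i. V a (b \<noteq> even i)) [1..<Suc k]"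
proof (induction k)
  case (Suc k)
  then show ?case
    unfolding alt_Suc_right by simp
qed simp

lemma count_list_replicate_True [simp]: "count_list (replicate k b) True = (if b then k else 0)"
  by (induction k) auto

lemma acc_replicate_True: "acc False (replicate p True) = map odd [1..<Suc p]"
proof (induction p)
  case (Suc p)
  have "acc False (replicate (Suc p) True) = acc False (replicate p True @ [True])"
    by (simp add: replicate_append_same)
  then show ?case
    unfolding acc_append Suc by simp
qed simp

lemma acc_replicate_False: "acc a (replicate q False) = replicate q a"
  by (induction q) auto

lemma word_unit_segments: "word (map2 plain as (replicate (length as) 0)) = concat (map (\<lambda>a. [Z, V a False]) as)"
  by (induction as) (simp_all add: word_simps)

section \<open>The two invariants and the canonical form\<close>

context z2_basis
begin

lemma n_num_prism_coloring: "n_num (length w) (prism_coloring w) = count_list w Z"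
proof -
  have "lambda0 (prism_coloring w) = val Z"
    by (simp add: lambda0_def comb_def)
  then have "{i. i < length w \<and> color (prism_coloring w) (Side i) = lambda0 (prism_coloring w)} =
      {i. i < length w \<and> w ! i = Z}"
    by (simp add: inj_eq[OF inj_val] del: val.simps cong: conj_cong)
  then show ?thesis
    by (simp add: n_num_def count_list_eq_length_filter length_filter_conv_card eq_commute)
qed

lemma m_num_prism_coloring:
  assumes "cyc_adj w" "length w > 1"
  shows "m_num (length w) (prism_coloring w) = cyc_turns w"
proof -
  \<comment> \<open>The padding shifts indices by one: for \<open>i < ?m\<close>,
    \<open>?w ! Suc i\<close> is \<open>w ! i\<close>, standing between its cyclic
    neighbours.\<close>
  let ?m = "length w" and ?w = "last w # w @ [hd w]"
  have "w \<noteq> []"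
    using assms by auto
  have prev: "?w ! i = w ! ((i + ?m - 1) mod ?m)" if "i < ?m" for i
  proof (cases i)
    case 0
    then show ?thesis
      using \<open>w \<noteq> []\<close> by (simp add: last_conv_nth)
  next
    case (Suc j)
    then show ?thesis
      using that by (simp add: nth_append)
  qed
  have succ: "?w ! Suc (Suc i) = w ! (Suc i mod ?m)" if "i < ?m" for i
  proof (cases "Suc i = ?m")
    case True
    then show ?thesis
      using \<open>w \<noteq> []\<close> by (simp add: hd_conv_nth nth_append)
  next
    case False
    then show ?thesis
      using that by (simp add: nth_append)
  qed
  have "vec.span {color (prism_coloring w) (Side ((i + ?m - 1) mod ?m)), color (prism_coloring w) (Side i),
        color (prism_coloring w) (Side (Suc i mod ?m))} = UNIV \<longleftrightarrow>
      ?w ! Suc i = Z \<and> mark (?w ! i) \<noteq> mark (?w ! Suc (Suc i))" if i: "i < ?m" for i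
  proof -
    let ?j = "(i + ?m - 1) mod ?m"
    have j: "?j < ?m" "Suc i mod ?m < ?m"
      using \<open>w \<noteq> []\<close> by simp_all
    have "Suc ?j mod ?m = i"
      using i \<open>w \<noteq> []\<close> by (simp add: mod_Suc_eq)
    then have "adj (w ! ?j) (w ! i)" "adj (w ! i) (w ! (Suc i mod ?m))"
      using assms(1)[unfolded cyc_adj_nth, rule_format, OF j(1)]
        assms(1)[unfolded cyc_adj_nth, rule_format, OF i] by simp_all
    from span_val_eq_UNIV_iff[OF this] show ?thesis
      using i j prev[OF i] succ[OF i] by (simp add: nth_append del: nth_Cons_Suc)
  qed
  moreover have "Suc (Suc i) < length ?w \<longleftrightarrow> i < ?m" for i
    by simp
  ultimately show ?thesis
    unfolding m_num_def cyc_turns_def turns_conv_card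
    by (intro arg_cong[where f = card] Collect_cong) blast
qed

text \<open>The first \<open>p\<close> segments have alternating marks, the others mark
  \<open>False\<close>. As \<open>p\<close> is even, the last mark is always \<open>False\<close>,
  so the excess letters form the alternating run at the end.\<close>

lemma canonical_sequence_word:
  assumes "even p" "p + q = Suc r"
  shows "map val (word (map2 plain (acc False (replicate p True @ replicate q False)) (replicate r 0 @ [k]))) =
    canonical_sequence e1 e2 e3 (k + 2 * (p + q)) p (p + q)"
proof -
  define as where "as = acc False (replicate p True @ replicate q False)"
  have as: "as = map odd [1..<Suc p] @ replicate q False"
    using assms(1) by (simp add: as_def acc_append acc_replicate_True acc_replicate_False del: upt_Suc)
  have len: "length as = Suc r"
    using assms(2) by (simp add: as_def)
  have ne: "replicate p True @ replicate q False \<noteq> []"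
    using assms(2) by (cases p) auto
  then have last: "last as = False" and "as \<noteq> []"
    using last_acc[OF ne, of False] assms(1) by (simp_all add: as_def)
  obtain bs where bs: "as = bs @ [False]"
    using append_butlast_last_id[OF \<open>as \<noteq> []\<close>, symmetric] unfolding last by blast
  then have bs_len: "length bs = r"
    using len by simp
  \<comment> \<open>The excess follows a letter of phase \<open>False\<close>, hence starts with
    phase \<open>True\<close>, that is with \<open>e2 + e3\<close>.\<close>
  have "word (map2 plain as (replicate r 0 @ [k])) = word (map2 plain as (replicate (length as) 0)) @ alt False True k"
    using bs_len by (simp add: bs word_simps flip: replicate_append_same)
  also have "\<dots> = concat (map (\<lambda>a. [Z, V a False]) as) @ map (\<lambda>i. V False (odd i)) [1..<Suc k]"
    unfolding word_unit_segments alt_conv_map by simp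
  finally have "map val (word (map2 plain as (replicate r 0 @ [k]))) =
    concat (map (\<lambda>a. [val Z, val (V a False)]) as) @ map (\<lambda>i. val (V False (odd i))) [1..<Suc k]"
    by (simp add: map_concat comp_def del: upt_Suc val.simps)
  moreover have "val Z = e2" "val (V a False) = (if a then e1 + e3 else e3)"
      "val (V False a) = (if a then e2 + e3 else e3)" for a
    by (simp_all add: comb_def)
  ultimately show ?thesis
    unfolding canonical_sequence_def as_def[symmetric]
    by (simp add: as comp_def map_replicate_const del: upt_Suc val.simps)
qed

lemma sim_canonical:
  assumes "ss \<noteq> []"
  defines "p \<equiv> count_list (deltas (last (map fst ss)) (map fst ss)) True"
  obtains w where "sim (word ss) w"
    "map val w = canonical_sequence e1 e2 e3 (length (word ss)) p (length ss)"
proof -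
  define as where "as = map fst ss"
  define ks where "ks = map (\<lambda>(a, b, k). k) ss"
  \<comment> \<open>The first segment is preceded cyclically by the last one.\<close>
  define a0 where "a0 = last as"
  define ds where "ds = deltas a0 as"
  define q where "q = count_list ds False"
  have p: "p = count_list ds True"
    by (simp add: p_def ds_def a0_def as_def)
  have "even p"
    using even_count_deltas[of as] assms(1) by (simp add: p ds_def a0_def as_def)
  have "count_list xs True + count_list xs False = length xs" for xs
    by (induction xs) auto
  then have pq: "p + q = length ss"
    using length_deltas[of a0 as] by (simp add: p q_def ds_def as_def)
  then obtain r where r: "p + q = Suc r"
    using assms(1) by (cases ss) auto
  have len: "length ks = length ss"
    by (simp add: ks_def)
  define sorted where "sorted = acc a0 (replicate p True @ replicate q False)"
  have sorted_len: "length sorted = Suc r"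
    using r by (simp add: sorted_def)
  have "map (\<lambda>(a, b, k). plain a k) ss = map2 plain as ks"
    unfolding as_def ks_def by (induction ss) auto
  then have "sim (word ss) (word (map2 plain as ks))"
    using sim_plain[of "[]" ss] by simp
  also have "sim \<dots> (word (map2 plain sorted ks))"
    using sim_sort[of "[]" ds ks a0] \<open>even p\<close> p q_def len by (simp add: ds_def sorted_def as_def)
  also have "sim \<dots> (word (map2 plain sorted (replicate r 0 @ [sum_list ks])))"
    using sim_collect[of ks sorted "[]"] sorted_len len pq r by (auto simp: length_0_conv[symmetric])
  \<comment> \<open>Adding \<open>a0\<close> to all marks makes the sequence start from
    \<open>False\<close>.\<close>
  also have "sim \<dots> (map (shear a0 False) (word (map2 plain sorted (replicate r 0 @ [sum_list ks]))))"
    by (rule sim_shear) simp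
  also have "\<dots> = word (map2 plain (acc False (replicate p True @ replicate q False)) (replicate r 0 @ [sum_list ks]))"
    unfolding map_shear_word sorted_def acc_flip by simp
  finally show ?thesis
  proof (rule that)
    show "map val (word (map2 plain (acc False (replicate p True @ replicate q False)) (replicate r 0 @ [sum_list ks]))) =
      canonical_sequence e1 e2 e3 (length (word ss)) p (length ss)"
      unfolding canonical_sequence_word[OF \<open>even p\<close> r] by (simp add: length_word ks_def pq)
  qed
qed

lemma sector_equivalent_canonical:
  assumes "cyc_adj w" "length w > 3"
  shows "sector_equivalent (length w) (prism_coloring w)
    (canonical_coloring e1 e2 e3 (length w) (cyc_turns w) (count_list w Z))"
proof (cases "Z \<in> set w")
  case True
  then obtain u v where w: "w = u @ Z # v"
    by (meson split_list)
  \<comment> \<open>Rotated to begin with \<open>Z\<close>, the word has no leading run and consists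
    of segments only.\<close>
  let ?w = "Z # v @ u"
  have cyc: "cyc_adj ?w"
    using cyc_adj_append_commute[of u "Z # v"] assms(1) w by simp
  then have "last ?w \<noteq> Z" "successively adj ?w"
    unfolding cyc_adj_def by auto
  then obtain a b k ss where "?w = alt a b k @ word ss"
    using alt_word_decomposition[of ?w] by blast
  then have ss: "?w = word ss"
    by (cases k) auto
  then have "ss \<noteq> []"
    by (auto simp: word_simps)
  have turns: "cyc_turns w = count_list (deltas (last (map fst ss)) (map fst ss)) True"
    using cyc_turns_append_commute[of u "Z # v"] w ss cyc_turns_word[OF \<open>ss \<noteq> []\<close>] by simp
  have "count_list w Z = count_list ?w Z"
    by (simp add: w)
  then have count: "count_list w Z = length ss"
    using ss count_list_word_Z by simp
  obtain w' where w': "sim (word ss) w'"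
    "map val w' = canonical_sequence e1 e2 e3 (length (word ss)) (cyc_turns w) (length ss)"
    using sim_canonical[OF \<open>ss \<noteq> []\<close>] turns by metis
  have "sim w ?w"
    using sim_rotate[of u "Z # v"] assms(1) w by simp
  then have "sim w w'"
    using w' ss sim_trans by metis
  moreover have "length (word ss) = length w"
    using w by (simp flip: ss)
  ultimately show ?thesis
    using w'(2) count assms(2) by (auto simp: sim_def canonical_coloring_def)
next
  case False
  have "w \<noteq> []"
    using assms(2) by auto
  then have "last w \<noteq> Z" "successively adj w"
    using False assms(1) last_in_set[of w] by (metis, simp add: cyc_adj_def)
  then obtain a b k ss where "w = alt a b k @ word ss"
    using alt_word_decomposition[of w] by blast
  moreover have "ss = []"
    using False calculation by (cases ss rule: word.cases) (auto simp: word_simps)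
  ultimately have w: "w = alt a b k"
    by (simp add: word_simps)
  \<comment> \<open>This choice sends mark \<open>a\<close> to \<open>False\<close> and initial
    phase \<open>b\<close> to \<open>True\<close>.\<close>
  have "sim w (map (shear a (\<not> b)) w)"
    by (rule sim_shear[OF assms(1)])
  also have "map (shear a (\<not> b)) w = alt False True k"
    unfolding w map_shear_alt by simp
  finally have sim: "sim w (alt False True k)" .
  have canonical: "map val (alt False True k) = canonical_sequence e1 e2 e3 k 0 0"
    unfolding alt_conv_map canonical_sequence_def by (simp add: comb_def comp_def del: upt_Suc)
  have "turns v = 0" if "Z \<notin> set v" for v
    using that by (induction v rule: turns.induct) auto
  moreover have "Z \<notin> set (last w # w @ [hd w])"
    using False \<open>w \<noteq> []\<close> hd_in_set[of w] last_in_set[of w] by (simp, metis)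
  ultimately have "cyc_turns w = 0"
    unfolding cyc_turns_def by blast
  with sim canonical show ?thesis
    using assms(2) False w by (simp add: sim_def canonical_coloring_def)
qed

end

theorem proposition5p9:
  fixes m :: nat and L :: coloring and e1 e2 e3 :: z2_cube
  assumes "m > 3"
    and "nontrivial_coloring m L"
    and "vec.independent {e1, e2, e3}" and "vec.span {e1, e2, e3} = UNIV"
    and "color L Ceiling = e1" and "color L Floor = e1 + e2"
  shows "sector_equivalent m L (canonical_coloring e1 e2 e3 m (m_num m L) (n_num m L))"
proof -
  interpret z2_basis e1 e2 e3
    using assms by unfold_locales
  obtain w where w: "L = prism_coloring w" "cyc_adj w" "length w = m"
    using nontrivial_coloring_cases[of m L] assms by auto
  then show ?thesis
    using sector_equivalent_canonical[of w] n_num_prism_coloring[of w] m_num_prism_coloring[of w] \<open>m > 3\<close>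
    by auto
qed

end
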